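(* For any $n \in \mathbb{N}$ and $\lambda \in \mathbb{R} \setminus \{0\}$, there exist sets $X,Y\subset\mathbb{R}$ and $G \subset X \times Y$ with $|G|=n^2$ such that \[ \max \{|X+_G Y|,\ |X+_G \lambda Y|,\ |X /_G Y|\} \ll n. \] In particular, $\max \{|X+_G Y|, |X+_G \lambda Y|, |X /_G Y|\} \ll |G|^{1/2}$.
   Context: For $X,Y\subset\mathbb{R}$ and $G\subset X\times Y$: $X+_G Y:=\{x+y : (x,y)\in G\}$, $X+_G \lambda Y:=\{x+\lambda y : (x,y)\in G\}$, and $X/_G Y:=\{x/y : (x,y)\in G\}$. The notation $X\ll Y$ means $X\le cY$ for some absolute constant $c>0$. *)

theory Defs
  imports Complex_Main
begin

text \<open>
  The sets \<open>X +\<^sub>G Y\<close>, \<open>X +\<^sub>G \<lambda>Y\<close> and \<open>X /\<^sub>G Y\<close> for \<open>G \<subseteq> X \<times> Y\<close>. They depend on \<open>X\<close> and \<open>Y\<close>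
  only through \<open>G\<close>, so \<open>X\<close> and \<open>Y\<close> are not arguments.
\<close>

definition sumset_along :: "(real \<times> real) set \<Rightarrow> real set" where
  "sumset_along G = {x + y | x y. (x, y) \<in> G}"

definition dilated_sumset_along :: "(real \<times> real) set \<Rightarrow> real \<Rightarrow> real set" where
  "dilated_sumset_along G lam = {x + lam * y | x y. (x, y) \<in> G}"

text \<open>
  Since \<open>x / 0 = 0\<close> in HOL, this is the intended set only if no pair of \<open>G\<close> has second
  coordinate \<open>0\<close>; statements about it should assert this separately.
\<close>

definition ratio_set_along :: "(real \<times> real) set \<Rightarrow> real set" where
  "ratio_set_along G = {x / y | x y. (x, y) \<in> G}"

end

theory Submission
  imports Defs
begin

text \<open>
  In the coordinates \<open>u = x + y\<close> and \<open>v = x + \<lambda>y\<close> the ratio \<open>x / y\<close> depends on \<open>u / v\<close> only, so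
  for \<open>\<lambda> \<noteq> 1\<close> one lets \<open>u\<close> and \<open>-v\<close> run through the same geometric progression of length \<open>n\<close>;
  the opposite signs keep \<open>u \<noteq> v\<close>, that is, \<open>y \<noteq> 0\<close>. For \<open>\<lambda> = 1\<close> the two sumsets
  coincide, and \<open>x + y\<close> and \<open>x / y\<close> can be prescribed independently.
\<close>

lemma card_le_if_subset_image_lessThan:
  assumes "A \<subseteq> f ` {..<m::nat}"
  shows "card A \<le> m"
  using surj_card_le[OF finite_lessThan assms] by simp

text \<open>With \<open>u = 2 ^ i\<close> and \<open>v = - (2 ^ j)\<close> the quotient
  \<open>u / v\<close> is determined by the difference \<open>i - j\<close>. For
  \<open>i, j < n\<close> there are fewer than \<open>2 * n\<close> differences, whence the weaker
  bound for the ratio set.\<close>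

lemma two_sums_one_ratio_grid:
  fixes lam :: real
  assumes "lam \<noteq> 1"
  shows "\<exists>G. finite G \<and> card G = n ^ 2 \<and> (\<forall>(x, y) \<in> G. y \<noteq> 0) \<and>
    card (sumset_along G) \<le> n \<and> card (dilated_sumset_along G lam) \<le> n \<and>
    card (ratio_set_along G) \<le> 2 * n"
proof -
  \<comment> \<open>Subtracting \<open>x + y = 2 ^ i\<close> from
    \<open>x + lam * y = - (2 ^ j)\<close> leaves
    \<open>(lam - 1) * y = - (2 ^ i + 2 ^ j)\<close>.\<close>
  define y where "y = (\<lambda>(i::nat) (j::nat). - (2 ^ i + 2 ^ j) / (lam - 1))"
  define x where "x = (\<lambda>i j. 2 ^ i - y i j)"
  define G where "G = (\<lambda>(i, j). (x i j, y i j)) ` ({..<n} \<times> {..<n})"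
  have sum: "x i j + y i j = 2 ^ i" for i j
    by (simp add: x_def)
  have dilated: "x i j + lam * y i j = - (2 ^ j)" for i j
  proof -
    have "(lam - 1) * y i j = - (2 ^ i + 2 ^ j)"
      using assms by (simp add: y_def)
    then show ?thesis
      by (simp add: x_def algebra_simps)
  qed
  have y_nonzero: "y i j \<noteq> 0" for i j
  proof -
    have "(0::real) < 2 ^ i + 2 ^ j"
      by (intro add_pos_pos) auto
    then show ?thesis
      using assms by (simp add: y_def)
  qed
  \<comment> \<open>Since \<open>x = 2 ^ i - y\<close>, the ratio is \<open>2 ^ i / y - 1\<close>.
    Expanding \<open>2 ^ i / (2 ^ i + 2 ^ j)\<close> by \<open>2 ^ n / 2 ^ j\<close> leaves
    \<open>i + n - j\<close> as the only parameter. The shift by \<open>n\<close> replaces the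
    possibly negative \<open>i - j\<close> by a natural number: \<open>j < n\<close> keeps the
    subtraction from truncating, and \<open>i < n\<close> will give
    \<open>i + n - j < 2 * n\<close>.\<close>
  have ratio: "x i j / y i j = - (lam - 1) * 2 ^ (i + n - j) / (2 ^ (i + n - j) + 2 ^ n) - 1"
    if "j < n" for i j
  proof -
    have "(2::real) ^ (i + n - j) * 2 ^ j = 2 ^ i * 2 ^ n"
      using that by (simp flip: power_add)
    then have k: "(2::real) ^ (i + n - j) = 2 ^ i * 2 ^ n / 2 ^ j"
      by (simp add: eq_divide_eq)
    have pos: "(0::real) < 2 ^ i + 2 ^ j"
      by (intro add_pos_pos) auto
    have "(2::real) ^ (i + n - j) + 2 ^ n = (2 ^ i + 2 ^ j) * (2 ^ n / 2 ^ j)"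
      unfolding k by (simp add: field_simps)
    then have "(2::real) ^ (i + n - j) / (2 ^ (i + n - j) + 2 ^ n) = 2 ^ i / (2 ^ i + 2 ^ j)"
      unfolding k using pos by (simp add: divide_simps)
    moreover have "x i j / y i j = 2 ^ i / y i j - 1"
      using y_nonzero by (simp add: x_def diff_divide_distrib)
    moreover have "2 ^ i / y i j = - (lam - 1) * (2 ^ i / (2 ^ i + 2 ^ j))"
      unfolding y_def using pos assms by (simp add: divide_simps) (simp add: algebra_simps)
    ultimately show ?thesis
      by (simp only: times_divide_eq_right [symmetric])
  qed
  \<comment> \<open>A point of the grid determines its two sums, and these determine
    \<open>i\<close> and \<open>j\<close>.\<close>
  have "inj_on (\<lambda>(i, j). (x i j, y i j)) ({..<n} \<times> {..<n})"
  proof (rule inj_onI, clarify)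
    fix i j i' j'
    assume "x i j = x i' j'" "y i j = y i' j'"
    then have "(2::real) ^ i = 2 ^ i'" "(2::real) ^ j = 2 ^ j'"
      using sum[of i j] sum[of i' j'] dilated[of i j] dilated[of i' j'] by simp_all
    then show "i = i' \<and> j = j'"
      by simp
  qed
  then have "card G = n ^ 2"
    by (simp add: G_def card_image card_cartesian_product power2_eq_square)
  moreover have "sumset_along G \<subseteq> (\<lambda>i. 2 ^ i) ` {..<n}"
    by (auto simp: sumset_along_def G_def sum)
  moreover have "dilated_sumset_along G lam \<subseteq> (\<lambda>j. - (2 ^ j)) ` {..<n}"
    by (auto simp: dilated_sumset_along_def G_def dilated)
  moreover have "ratio_set_along G \<subseteq>
      (\<lambda>k. - (lam - 1) * 2 ^ k / (2 ^ k + 2 ^ n) - 1) ` {..<2 * n}"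
  proof
    fix r
    assume "r \<in> ratio_set_along G"
    then obtain i j where "i < n" "j < n" "r = x i j / y i j"
      by (auto simp: ratio_set_along_def G_def)
    then show "r \<in> (\<lambda>k. - (lam - 1) * 2 ^ k / (2 ^ k + 2 ^ n) - 1) ` {..<2 * n}"
      by (intro image_eqI[of _ _ "i + n - j"]) (simp_all only: ratio, simp)
  qed
  moreover have "finite G" "\<forall>(x, y) \<in> G. y \<noteq> 0"
    by (auto simp: G_def y_nonzero)
  ultimately show ?thesis
    by (meson card_le_if_subset_image_lessThan)
qed

text \<open>A sum \<open>s\<close> and a ratio \<open>r \<noteq> -1\<close> are attained together by
  \<open>y = s / (r + 1)\<close> and \<open>x = r * y\<close>, with \<open>y \<noteq> 0\<close> as
  soon as \<open>s \<noteq> 0\<close>. The grid takes \<open>s = i + 1\<close> and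
  \<open>r = j + 1\<close>, which are positive.\<close>

lemma sum_ratio_grid:
  "\<exists>G. finite G \<and> card G = n ^ 2 \<and> (\<forall>(x, y) \<in> G. y \<noteq> 0) \<and>
    card (sumset_along G) \<le> n \<and> card (ratio_set_along G) \<le> n"
proof -
  define y where "y = (\<lambda>i j. (real i + 1) / (real j + 2))"
  define x where "x = (\<lambda>i j. (real j + 1) * y i j)"
  define G where "G = (\<lambda>(i, j). (x i j, y i j)) ` ({..<n} \<times> {..<n})"
  have sum: "x i j + y i j = real i + 1" for i j
  proof -
    have "x i j + y i j = (real j + 2) * y i j"
      by (simp add: x_def algebra_simps)
    then show ?thesis
      by (simp add: y_def)
  qed
  have y_nonzero: "y i j \<noteq> 0" for i j
    by (simp add: y_def)
  have ratio: "x i j / y i j = real j + 1" for i j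
    using y_nonzero by (simp add: x_def)
  \<comment> \<open>Here the sum recovers \<open>i\<close> and the ratio recovers
    \<open>j\<close>.\<close>
  have "inj_on (\<lambda>(i, j). (x i j, y i j)) ({..<n} \<times> {..<n})"
  proof (rule inj_onI, clarify)
    fix i j i' j'
    assume "x i j = x i' j'" "y i j = y i' j'"
    then show "i = i' \<and> j = j'"
      using sum[of i j] sum[of i' j'] ratio[of i j] ratio[of i' j'] by simp
  qed
  then have "card G = n ^ 2"
    by (simp add: G_def card_image card_cartesian_product power2_eq_square)
  moreover have "sumset_along G \<subseteq> (\<lambda>i. real i + 1) ` {..<n}"
    by (auto simp: sumset_along_def G_def sum)
  moreover have "ratio_set_along G \<subseteq> (\<lambda>j. real j + 1) ` {..<n}"
    by (auto simp: ratio_set_along_def G_def ratio)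
  moreover have "finite G" "\<forall>(x, y) \<in> G. y \<noteq> 0"
    by (auto simp: G_def y_nonzero)
  ultimately show ?thesis
    by (meson card_le_if_subset_image_lessThan)
qed

theorem theorem5p1:
  shows "\<exists>c::real. c > 0 \<and>
    (\<forall>(n::nat) (lam::real). lam \<noteq> 0 \<longrightarrow>
      (\<exists>(X::real set) (Y::real set) (G::(real \<times> real) set).
        G \<subseteq> X \<times> Y \<and> finite G \<and> card G = n ^ 2 \<and>
        (\<forall>(x, y) \<in> G. y \<noteq> 0) \<and>
        real (Max {card (sumset_along G), card (dilated_sumset_along G lam),
                   card (ratio_set_along G)}) \<le> c * real n \<and>
        real (Max {card (sumset_along G), card (dilated_sumset_along G lam),
                   card (ratio_set_along G)}) \<le> c * sqrt (real (card G))))"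
proof (intro exI[of _ 2] conjI allI impI)
  fix n :: nat and lam :: real
  \<comment> \<open>The constant 2 comes from the ratio set in the case
    \<open>lam \<noteq> 1\<close>; all other bounds are relaxed to match it.\<close>
  have "\<exists>G. finite G \<and> card G = n ^ 2 \<and> (\<forall>(x, y) \<in> G. y \<noteq> 0) \<and>
    card (sumset_along G) \<le> 2 * n \<and> card (dilated_sumset_along G lam) \<le> 2 * n \<and>
    card (ratio_set_along G) \<le> 2 * n"
  proof (cases "lam = 1")
    case True
    obtain G where "finite G" "card G = n ^ 2" "\<forall>(x, y) \<in> G. y \<noteq> 0"
      "card (sumset_along G) \<le> n" "card (ratio_set_along G) \<le> n"
      using sum_ratio_grid by blast
    moreover have "dilated_sumset_along G 1 = sumset_along G"
      by (simp add: dilated_sumset_along_def sumset_along_def)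
    ultimately show ?thesis
      using True by (intro exI[of _ G]) simp
  next
    case False
    obtain G where "finite G" "card G = n ^ 2" "\<forall>(x, y) \<in> G. y \<noteq> 0"
      "card (sumset_along G) \<le> n" "card (dilated_sumset_along G lam) \<le> n"
      "card (ratio_set_along G) \<le> 2 * n"
      using two_sums_one_ratio_grid[OF False] by blast
    then show ?thesis
      by (intro exI[of _ G]) simp
  qed
  then obtain G where G: "finite G" "card G = n ^ 2" "\<forall>(x, y) \<in> G. y \<noteq> 0"
    and "card (sumset_along G) \<le> 2 * n" "card (dilated_sumset_along G lam) \<le> 2 * n"
      "card (ratio_set_along G) \<le> 2 * n"
    by blast
  then have "Max {card (sumset_along G), card (dilated_sumset_along G lam),
      card (ratio_set_along G)} \<le> 2 * n"
    by simp
  then have "real (Max {card (sumset_along G), card (dilated_sumset_along G lam),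
      card (ratio_set_along G)}) \<le> 2 * real n"
    by (metis of_nat_le_iff of_nat_mult of_nat_numeral)
  moreover have "sqrt (real (card G)) = real n"
    by (simp add: G(2))
  \<comment> \<open>The projections of \<open>G\<close> serve as \<open>X\<close> and
    \<open>Y\<close>.\<close>
  moreover have "G \<subseteq> fst ` G \<times> snd ` G"
    by (rule subset_fst_snd)
  ultimately show "\<exists>X Y G. G \<subseteq> X \<times> Y \<and> finite G \<and> card G = n ^ 2 \<and>
        (\<forall>(x, y) \<in> G. y \<noteq> 0) \<and>
        real (Max {card (sumset_along G), card (dilated_sumset_along G lam),
                   card (ratio_set_along G)}) \<le> 2 * real n \<and>
        real (Max {card (sumset_along G), card (dilated_sumset_along G lam),
                   card (ratio_set_along G)}) \<le> 2 * sqrt (real (card G))"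
    using G by metis
qed simp

end
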